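(* Let $X$ be a graph on $n$ vertices whose number of spanning trees is a power of two. Let $u,v$ be vertices of $X$ and let $\lambda\neq 0$ be an integer Laplacian eigenvalue of $X$. If $\lambda\in\Lambda_{uv}^-$, then $\lambda$ is a power of two.
   Context: Graphs are finite, simple and undirected. For a graph $X$ with adjacency matrix $A$ and diagonal degree matrix $D$, the Laplacian matrix is $L=D-A$, with spectral decomposition $L=\sum_{r=0}^d \lambda_r F_r$, where $\lambda_0<\dots<\lambda_d$ are the distinct eigenvalues and $F_r$ is the orthogonal projection onto the $\lambda_r$-eigenspace. For a vertex $u$, $\mathbf{e}_u$ is its characteristic vector; $\Lambda_u=\{\lambda_r : F_r\mathbf{e}_u\neq 0\}$ and $\Lambda_{uv}^-=\{\lambda_r\in\Lambda_u : F_r\mathbf{e}_u=-F_r\mathbf{e}_v\}$. Powers of two include $2^0=1$. *)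

theory Defs
  imports "HOL-Analysis.Analysis"
begin

text \<open>A graph has a finite type \<open>'v\<close> as its vertex set and is given by its edge set.\<close>

definition simple_graph :: "'v::finite set set \<Rightarrow> bool" where
  "simple_graph E \<longleftrightarrow> (\<forall>e\<in>E. card e = 2)"

definition graph_connected :: "'v::finite set set \<Rightarrow> bool" where
  "graph_connected E \<longleftrightarrow> (\<forall>u v. (u, v) \<in> {(x, y). {x, y} \<in> E}\<^sup>*)"

definition graph_cycle :: "'v::finite set set \<Rightarrow> 'v list \<Rightarrow> bool" where
  "graph_cycle E p \<longleftrightarrow> 3 \<le> length p \<and> distinct p \<and>
     (\<forall>i<length p. {p ! i, p ! (Suc i mod length p)} \<in> E)"

definition spanning_tree :: "'v::finite set set \<Rightarrow> 'v set set \<Rightarrow> bool" where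
  "spanning_tree E T \<longleftrightarrow> T \<subseteq> E \<and> graph_connected T \<and> (\<nexists>p. graph_cycle T p)"

definition num_spanning_trees :: "'v::finite set set \<Rightarrow> nat" where
  "num_spanning_trees E = card {T. spanning_tree E T}"

definition adjacency_matrix :: "'v::finite set set \<Rightarrow> real^'v^'v" where
  "adjacency_matrix E = (\<chi> i j. if {i, j} \<in> E then 1 else 0)"

definition vertex_degree :: "'v::finite set set \<Rightarrow> 'v \<Rightarrow> nat" where
  "vertex_degree E v = card {e \<in> E. v \<in> e}"

definition degree_matrix :: "'v::finite set set \<Rightarrow> real^'v^'v" where
  "degree_matrix E = (\<chi> i j. if i = j then real (vertex_degree E i) else 0)"

definition laplacian_matrix :: "'v::finite set set \<Rightarrow> real^'v^'v" where
  "laplacian_matrix E = degree_matrix E - adjacency_matrix E"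

definition laplacian_eigenspace :: "'v::finite set set \<Rightarrow> real \<Rightarrow> (real^'v) set" where
  "laplacian_eigenspace E \<theta> = {x. laplacian_matrix E *v x = \<theta> *\<^sub>R x}"

definition laplacian_eigenvalue :: "'v::finite set set \<Rightarrow> real \<Rightarrow> bool" where
  "laplacian_eigenvalue E \<theta> \<longleftrightarrow> (\<exists>x. x \<noteq> 0 \<and> laplacian_matrix E *v x = \<theta> *\<^sub>R x)"

definition orthogonal_projection :: "'a::euclidean_space set \<Rightarrow> 'a \<Rightarrow> 'a" where
  "orthogonal_projection S x = (THE y. y \<in> S \<and> (\<forall>z\<in>S. orthogonal (x - y) z))"

lemma orthogonal_projection_unique:
  fixes S :: "'a::euclidean_space set"
  assumes "subspace S"
  shows "\<exists>!y. y \<in> S \<and> (\<forall>z\<in>S. orthogonal (x - y) z)"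
proof (rule ex_ex1I)
  obtain y z where "y \<in> span S" "\<And>w. w \<in> span S \<Longrightarrow> orthogonal z w" "x = y + z"
    using orthogonal_subspace_decomp_exists by blast
  moreover have "span S = S"
    using assms by (simp add: span_eq_iff)
  ultimately show "\<exists>y. y \<in> S \<and> (\<forall>z\<in>S. orthogonal (x - y) z)"
    by (metis add_diff_cancel_left')
next
  fix y y'
  assume y: "y \<in> S \<and> (\<forall>z\<in>S. orthogonal (x - y) z)"
    and y': "y' \<in> S \<and> (\<forall>z\<in>S. orthogonal (x - y') z)"
  have "y - y' \<in> S"
    using assms y y' by (simp add: subspace_diff)
  then have "(x - y') \<bullet> (y - y') = 0" "(x - y) \<bullet> (y - y') = 0"
    using y y' by (auto simp: orthogonal_def)
  then have "(y - y') \<bullet> (y - y') = 0"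
    by (simp add: inner_diff_left)
  then show "y = y'"
    by simp
qed

lemma subspace_laplacian_eigenspace: "subspace (laplacian_eigenspace E \<theta>)"
  by (simp add: laplacian_eigenspace_def subspace_def matrix_vector_right_distrib
      scaleR_right_distrib matrix_vector_mult_scaleR)

text \<open>For an eigenvalue \<open>\<theta> = \<lambda>\<^sub>r\<close>, this is \<open>F\<^sub>r\<close> as a linear map; \<open>e\<^sub>u\<close> is \<open>axis u 1\<close>.\<close>

definition laplacian_proj :: "'v::finite set set \<Rightarrow> real \<Rightarrow> real^'v \<Rightarrow> real^'v" where
  "laplacian_proj E \<theta> = orthogonal_projection (laplacian_eigenspace E \<theta>)"

definition eigenvalue_support :: "'v::finite set set \<Rightarrow> 'v \<Rightarrow> real set" where
  "eigenvalue_support E u =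
     {\<theta>. laplacian_eigenvalue E \<theta> \<and> laplacian_proj E \<theta> (axis u 1) \<noteq> 0}"

definition eigenvalue_support_minus :: "'v::finite set set \<Rightarrow> 'v \<Rightarrow> 'v \<Rightarrow> real set" where
  "eigenvalue_support_minus E u v =
     {\<theta> \<in> eigenvalue_support E u.
        laplacian_proj E \<theta> (axis u 1) = - laplacian_proj E \<theta> (axis v 1)}"

end

theory Submission
  imports Defs "HOL-Library.Transitive_Closure_Table"
begin

text \<open>
  Let \<open>L\<close> be the Laplacian and \<open>\<tau>\<close> the number of spanning trees. For a function \<open>x\<close> on the vertices,
  telescope \<open>x s - x r\<close> along the \<open>s\<close>-\<open>r\<close> path of every spanning tree. Deleting a path edge from its
  tree leaves a spanning forest with two components that separates \<open>s\<close> from \<open>r\<close>, and such a forest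
  arises exactly once from each edge of the graph that leaves the component \<open>C\<close> of \<open>s\<close>. Its terms
  therefore add up to the sum of \<open>L x\<close> over \<open>C\<close>, so \<open>\<tau> (x s - x r)\<close> is a sum of entries of \<open>L x\<close>.

  Let \<open>z\<close> be an integer eigenvector for \<open>m\<close> with \<open>z u = - z v\<close>, and let \<open>g\<close> be the gcd of its
  entries. Adding the cases \<open>r = u\<close> and \<open>r = v\<close> shows that \<open>m g\<close> divides \<open>2 \<tau> z s\<close> for every \<open>s\<close>,
  hence \<open>m\<close> divides \<open>2 \<tau>\<close>. A rational eigenvector comes from a real one by
  applying a \<open>\<rat>\<close>-linear functional \<open>\<real> \<rightarrow> \<rat>\<close> to its entries; clearing denominators makes it integral.
\<close>

section \<open>Components\<close>

definition component :: "'v set set \<Rightarrow> 'v \<Rightarrow> 'v set" where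
  "component F s = {w. (s, w) \<in> {(x, y). {x, y} \<in> F}\<^sup>*}"

lemma component_refl [simp]: "s \<in> component F s"
  by (simp add: component_def)

lemma component_sym: "w \<in> component F s \<Longrightarrow> s \<in> component F w"
  unfolding component_def mem_Collect_eq
  by (rule symD[OF sym_rtrancl]) (auto simp: sym_def insert_commute)

lemma component_trans: "v \<in> component F w \<Longrightarrow> w \<in> component F s \<Longrightarrow> v \<in> component F s"
  by (auto simp: component_def)

lemma component_eq_iff: "component F w = component F s \<longleftrightarrow> w \<in> component F s"
proof
  assume "component F w = component F s"
  then show "w \<in> component F s" by (metis component_refl)
next
  assume "w \<in> component F s"
  then show "component F w = component F s"
    by (auto intro: component_trans component_sym)
qed

lemma component_mono: "F \<subseteq> G \<Longrightarrow> component F s \<subseteq> component G s"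
  unfolding component_def
  by (intro Collect_mono impI, erule rtrancl_mono[THEN subsetD, rotated]) auto

lemma adjacent_in_component: "{a, b} \<in> F \<Longrightarrow> b \<in> component F a"
  by (auto simp: component_def)

lemma component_edge_iff: "{a, b} \<in> F \<Longrightarrow> a \<in> component F s \<longleftrightarrow> b \<in> component F s"
  by (metis adjacent_in_component component_sym component_trans)

lemma component_induct [consumes 1, case_names base step]:
  assumes "w \<in> component F s" and "P s"
    and "\<And>y z. y \<in> component F s \<Longrightarrow> {y, z} \<in> F \<Longrightarrow> P y \<Longrightarrow> P z"
  shows "P w"
  using assms(1) unfolding component_def mem_Collect_eq
  by (rule rtrancl_induct) (use assms(2,3) in \<open>auto simp: component_def\<close>)

lemma component_insert_edge:
  "component (insert {a, b} F) s =
    (if a \<in> component F s \<or> b \<in> component F s then component F a \<union> component F b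
     else component F s)"
proof -
  have insert_arcs:
    "{(x, y). {x, y} \<in> insert {a, b} F} = insert (a, b) (insert (b, a) {(x, y). {x, y} \<in> F})"
    by (auto simp: doubleton_eq_iff)
  have "w \<in> component (insert {a, b} F) s \<longleftrightarrow> w \<in> component F s
      \<or> (a \<in> component F s \<or> b \<in> component F s) \<and> w \<in> component F a \<union> component F b" for w
    unfolding component_def mem_Collect_eq insert_arcs rtrancl_insert by auto
  then show ?thesis
    using component_eq_iff[of F a s] component_eq_iff[of F b s] by (auto simp del: Un_iff)
qed

lemma graph_connected_iff: "graph_connected T \<longleftrightarrow> (\<forall>s. component T s = UNIV)"
  by (auto simp: graph_connected_def component_def)

lemma graph_connected_iff_component: "graph_connected T \<longleftrightarrow> component T s = UNIV"
  unfolding graph_connected_iff by (metis UNIV_I component_eq_iff)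

section \<open>Forests\<close>

definition forest :: "'v set set \<Rightarrow> bool" where
  "forest F \<longleftrightarrow> (\<forall>a b. {a, b} \<in> F \<longrightarrow> b \<notin> component (F - {{a, b}}) a)"

lemma forest_bridge: "forest F \<Longrightarrow> {a, b} \<in> F \<Longrightarrow> b \<notin> component (F - {{a, b}}) a"
  by (simp add: forest_def)

lemma forest_subset:
  assumes "forest G" "F \<subseteq> G"
  shows "forest F"
  unfolding forest_def
proof (intro allI impI)
  fix a b
  assume "{a, b} \<in> F"
  then have "{a, b} \<in> G" using assms(2) by blast
  then have "b \<notin> component (G - {{a, b}}) a" by (rule forest_bridge[OF assms(1)])
  moreover have "component (F - {{a, b}}) a \<subseteq> component (G - {{a, b}}) a"
    using assms(2) by (intro component_mono) blast
  ultimately show "b \<notin> component (F - {{a, b}}) a" by blast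
qed

lemma forest_insert_edge:
  assumes "forest F" and separated: "d \<notin> component F c"
  shows "forest (insert {c, d} F)"
  unfolding forest_def
proof (intro allI impI)
  fix a b
  assume edge: "{a, b} \<in> insert {c, d} F"
  show "b \<notin> component (insert {c, d} F - {{a, b}}) a"
  proof (cases "{a, b} = {c, d}")
    case True
    have "{c, d} \<notin> F" using separated adjacent_in_component by metis
    then have "insert {c, d} F - {{a, b}} = F" using True by simp
    moreover have "a = c \<and> b = d \<or> a = d \<and> b = c" using True by (simp add: doubleton_eq_iff)
    ultimately show ?thesis using separated component_sym by metis
  next
    case False
    let ?G = "F - {{a, b}}"
    have "{a, b} \<in> F" using edge False by blast
    then have not_in_G: "b \<notin> component ?G a" and connected_in_F: "b \<in> component F a"
      using forest_bridge[OF assms(1)] adjacent_in_component by metis+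
    have G_F: "component ?G x \<subseteq> component F x" for x by (intro component_mono) blast
    have "b \<notin> component (insert {c, d} ?G) a"
    proof
      assume "b \<in> component (insert {c, d} ?G) a"
      then have "c \<in> component ?G a \<and> b \<in> component ?G d \<or> d \<in> component ?G a \<and> b \<in> component ?G c"
        using not_in_G component_eq_iff[of ?G]
        by (auto simp: component_insert_edge split: if_splits)
      then have "c \<in> component F a \<and> b \<in> component F d \<or> d \<in> component F a \<and> b \<in> component F c"
        using G_F by blast
      then show False using connected_in_F separated by (metis component_eq_iff)
    qed
    also have "insert {c, d} ?G = insert {c, d} F - {{a, b}}" using False by blast
    finally show ?thesis .
  qed
qed

lemma graph_cycle_through_non_bridge:
  assumes "{a, b} \<in> F" "a \<noteq> b" "b \<in> component (F - {{a, b}}) a"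
  shows "\<exists>p. graph_cycle F p"
proof -
  define adj where "adj x y \<longleftrightarrow> {x, y} \<in> F - {{a, b}}" for x y
  have "adj\<^sup>*\<^sup>* a b"
    using assms(3) by (simp add: component_def adj_def rtranclp_rtrancl_eq)
  then obtain xs where path: "rtrancl_path adj a xs b" and distinct: "distinct (a # xs)"
    by (metis rtranclp_eq_rtrancl_path rtrancl_path_distinct)
  let ?p = "a # xs"
  have "xs \<noteq> []"
    using path assms(2) by (auto elim: rtrancl_path.cases)
  then have last: "?p ! length xs = b"
    using rtrancl_path_last[OF path] by (simp add: last_conv_nth)
  have step: "{?p ! i, ?p ! Suc i} \<in> F - {{a, b}}" if "i < length xs" for i
    using rtrancl_path_nth[OF path that] by (simp add: adj_def)
  have "length xs \<noteq> 1"
    using step[of 0] last \<open>xs \<noteq> []\<close> by auto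
  with \<open>xs \<noteq> []\<close> have "3 \<le> length ?p"
    by (cases xs) (auto simp: Suc_le_eq)
  moreover have "{?p ! i, ?p ! (Suc i mod length ?p)} \<in> F" if "i < length ?p" for i
  proof (cases "i < length xs")
    case True
    then show ?thesis using step by auto
  next
    case False
    then have "i = length xs" using that by simp
    then show ?thesis using last assms(1) by (simp add: insert_commute)
  qed
  ultimately show ?thesis using distinct unfolding graph_cycle_def by blast
qed

lemma not_forest_if_graph_cycle:
  assumes "graph_cycle F p"
  shows "\<not> forest F"
proof
  assume "forest F"
  define n where "n = length p"
  define last_edge where "last_edge = {p ! 0, p ! (n - 1)}"
  have length_ge: "3 \<le> n"
    using assms by (simp add: graph_cycle_def n_def)
  have edge: "{p ! i, p ! (Suc i mod n)} \<in> F" if "i < n" for i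
    using assms that by (simp add: graph_cycle_def n_def)
  have inj: "p ! i = p ! j \<longleftrightarrow> i = j" if "i < n" "j < n" for i j
    using assms that by (simp add: graph_cycle_def n_def nth_eq_iff_index_eq)
  have "p ! i \<in> component (F - {last_edge}) (p ! 0)" if "i < n" for i
    using that
  proof (induction i)
    case 0
    show ?case by simp
  next
    case (Suc i)
    have "{p ! i, p ! Suc i} \<noteq> last_edge"
      using Suc.prems length_ge inj by (auto simp: last_edge_def doubleton_eq_iff)
    then have "{p ! i, p ! Suc i} \<in> F - {last_edge}"
      using edge[of i] Suc.prems by simp
    then show ?case
      using Suc component_edge_iff by (metis Suc_lessD)
  qed
  moreover have "last_edge \<in> F"
    using edge[of "n - 1"] length_ge by (simp add: last_edge_def insert_commute)
  ultimately show False
    using \<open>forest F\<close> length_ge unfolding last_edge_def by (auto dest!: forest_bridge)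
qed

lemma forest_iff_no_graph_cycle:
  assumes "simple_graph F"
  shows "forest F \<longleftrightarrow> (\<nexists>p. graph_cycle F p)"
proof -
  have "a \<noteq> b" if "{a, b} \<in> F" for a b
    using assms that by (fastforce simp: simple_graph_def)
  then show ?thesis
    using graph_cycle_through_non_bridge not_forest_if_graph_cycle
    unfolding forest_def by metis
qed

lemma spanning_tree_iff:
  assumes "simple_graph E"
  shows "spanning_tree E T \<longleftrightarrow> T \<subseteq> E \<and> graph_connected T \<and> forest T"
proof -
  have "simple_graph T" if "T \<subseteq> E"
    using assms that by (auto simp: simple_graph_def)
  then show ?thesis
    using forest_iff_no_graph_cycle by (auto simp: spanning_tree_def)
qed

section \<open>Telescoping along tree paths\<close>

text \<open>In a forest the pairs below are the arcs of the path \<open>s \<dots> a - b \<dots> r\<close>.\<close>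

definition path_arcs :: "'v set set \<Rightarrow> 'v \<Rightarrow> 'v \<Rightarrow> ('v \<times> 'v) set" where
  "path_arcs T s r = {(a, b). {a, b} \<in> T \<and> a \<in> component (T - {{a, b}}) s
     \<and> r \<in> component (T - {{a, b}}) b}"

lemma path_arcs_refl:
  assumes "forest T"
  shows "path_arcs T s s = {}"
proof -
  have "(a, b) \<notin> path_arcs T s s" for a b
    using forest_bridge[OF assms, of a b] component_sym component_trans
    unfolding path_arcs_def by fast
  then show ?thesis by auto
qed

lemma path_arcs_extend:
  assumes "forest T" "{q, r} \<in> T" and near: "q \<in> component (T - {{q, r}}) s"
  shows "path_arcs T s r = insert (q, r) (path_arcs T s q)" and "(q, r) \<notin> path_arcs T s q"
proof -
  let ?F = "T - {{q, r}}"
  have bridge: "r \<notin> component ?F q"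
    using assms(1,2) by (rule forest_bridge)
  then have far: "r \<notin> component ?F s"
    using near by (metis component_eq_iff)
  have "(a, b) \<in> path_arcs T s r \<longleftrightarrow> (a, b) \<in> insert (q, r) (path_arcs T s q)" for a b
  proof (cases "{a, b} = {q, r}")
    case True
    then have "a = q \<and> b = r \<or> a = r \<and> b = q" by (simp add: doubleton_eq_iff)
    then show ?thesis
      using near far assms(2) by (auto simp: path_arcs_def insert_commute)
  next
    case False
    then have "{q, r} \<in> T - {{a, b}}" using assms(2) by blast
    then have "q \<in> component (T - {{a, b}}) b \<longleftrightarrow> r \<in> component (T - {{a, b}}) b"
      by (rule component_edge_iff)
    then show ?thesis using False by (auto simp: path_arcs_def)
  qed
  then show "path_arcs T s r = insert (q, r) (path_arcs T s q)" by auto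
  show "(q, r) \<notin> path_arcs T s q"
    using bridge component_sym[of q ?F r] by (auto simp: path_arcs_def)
qed

lemma sum_path_arcs:
  fixes x :: "'v::finite \<Rightarrow> 'a::ab_group_add"
  assumes "forest T" "r \<in> component T s"
  shows "(\<Sum>(a, b)\<in>path_arcs T s r. x a - x b) = x s - x r"
  using assms(2)
proof (induction rule: component_induct)
  case base
  show ?case by (simp add: path_arcs_refl[OF assms(1)])
next
  case (step q r)
  have edge: "{q, r} \<in> T" "{r, q} \<in> T"
    using step.hyps by (simp_all add: insert_commute)
  have "insert {q, r} (T - {{q, r}}) = T" using edge by blast
  then consider (forwards) "q \<in> component (T - {{q, r}}) s"
    | (backwards) "r \<in> component (T - {{r, q}}) s"
    using step.hyps component_insert_edge[of q r "T - {{q, r}}" s]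
    by (auto simp: insert_commute split: if_splits)
  then show ?case
  proof cases
    case forwards
    from path_arcs_extend[OF assms(1) edge(1) this] step.IH show ?thesis by simp
  next
    case backwards
    from path_arcs_extend[OF assms(1) edge(2) this] step.IH show ?thesis
      by (simp add: algebra_simps)
  qed
qed

definition cut_arcs :: "'v set set \<Rightarrow> 'v set \<Rightarrow> ('v \<times> 'v) set" where
  "cut_arcs E C = {(a, b). {a, b} \<in> E \<and> a \<in> C \<and> b \<notin> C}"

definition separating_forests :: "'v set set \<Rightarrow> 'v \<Rightarrow> 'v \<Rightarrow> 'v set set set" where
  "separating_forests E s r = {F. F \<subseteq> E \<and> forest F \<and> r \<notin> component F s
     \<and> component F s \<union> component F r = UNIV}"

lemma spanning_tree_remove_path_arc:
  assumes "simple_graph E" "spanning_tree E T" and path_arc: "(a, b) \<in> path_arcs T s r"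
  shows "T - {{a, b}} \<in> separating_forests E s r"
    and "(a, b) \<in> cut_arcs E (component (T - {{a, b}}) s)"
proof -
  let ?F = "T - {{a, b}}"
  have tree: "T \<subseteq> E" "forest T" "component T s = UNIV"
    using assms(1,2) by (simp_all add: spanning_tree_iff graph_connected_iff)
  have edge: "{a, b} \<in> T" and comp_a: "component ?F a = component ?F s"
    and comp_r: "component ?F r = component ?F b"
    using path_arc by (simp_all add: path_arcs_def component_eq_iff)
  have b_outside: "b \<notin> component ?F s"
    using forest_bridge[OF tree(2) edge] comp_a by simp
  then show "(a, b) \<in> cut_arcs E (component ?F s)"
    using tree(1) edge comp_a component_refl[of a ?F] by (auto simp: cut_arcs_def)
  have "r \<notin> component ?F s"
    using b_outside comp_r by (metis component_eq_iff)
  moreover have "component ?F s \<union> component ?F r = UNIV"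
  proof -
    have "insert {a, b} ?F = T" using edge by blast
    then show ?thesis
      using tree(3) component_insert_edge[of a b ?F s] component_refl[of a ?F] comp_a comp_r by simp
  qed
  moreover have "forest ?F" using tree(2) by (rule forest_subset) blast
  ultimately show "?F \<in> separating_forests E s r"
    using tree(1) by (auto simp: separating_forests_def)
qed

lemma separating_forest_insert_cut_arc:
  assumes "simple_graph E" "F \<in> separating_forests E s r"
    and cut_arc: "(a, b) \<in> cut_arcs E (component F s)"
  shows "spanning_tree E (insert {a, b} F)" and "{a, b} \<notin> F"
    and "(a, b) \<in> path_arcs (insert {a, b} F) s r"
proof -
  have forest: "F \<subseteq> E" "forest F" "component F s \<union> component F r = UNIV"
    using assms(2) by (simp_all add: separating_forests_def)
  have edge: "{a, b} \<in> E" and b_outside: "b \<notin> component F s"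
    and comp_a: "component F a = component F s"
    using cut_arc by (simp_all add: cut_arcs_def component_eq_iff)
  have comp_b: "component F b = component F r"
    using b_outside forest(3) component_eq_iff[of F b r] by blast
  have "component (insert {a, b} F) s = UNIV"
    using forest(3) component_refl[of a F] comp_a comp_b by (simp add: component_insert_edge)
  moreover have "forest (insert {a, b} F)"
    using forest(2) b_outside comp_a by (simp add: forest_insert_edge)
  ultimately show "spanning_tree E (insert {a, b} F)"
    using assms(1) forest(1) edge
    by (simp add: spanning_tree_iff graph_connected_iff_component[of _ s])
  show "{a, b} \<notin> F"
    using component_edge_iff[of a b F s] component_refl[of a F] comp_a b_outside by blast
  then show "(a, b) \<in> path_arcs (insert {a, b} F) s r"
    using component_refl[of a F] component_refl[of r F] comp_a comp_b by (simp add: path_arcs_def)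
qed

lemma bij_betw_delete_path_arc:
  assumes "simple_graph E"
  shows "bij_betw (\<lambda>(T, a, b). (T - {{a, b}}, a, b))
    (SIGMA T:{T. spanning_tree E T}. path_arcs T s r)
    (SIGMA F:separating_forests E s r. cut_arcs E (component F s))"
proof (rule bij_betw_byWitness[where f' = "\<lambda>(F, a, b). (insert {a, b} F, a, b)"])
  show "\<forall>t\<in>SIGMA T:{T. spanning_tree E T}. path_arcs T s r.
      (\<lambda>(F, a, b). (insert {a, b} F, a, b)) ((\<lambda>(T, a, b). (T - {{a, b}}, a, b)) t) = t"
    by (auto simp: path_arcs_def)
  show "\<forall>t\<in>SIGMA F:separating_forests E s r. cut_arcs E (component F s).
      (\<lambda>(T, a, b). (T - {{a, b}}, a, b)) ((\<lambda>(F, a, b). (insert {a, b} F, a, b)) t) = t"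
    using separating_forest_insert_cut_arc(2)[OF assms] by auto
qed (auto intro: spanning_tree_remove_path_arc[OF assms] separating_forest_insert_cut_arc[OF assms])

section \<open>The Laplacian\<close>

definition graph_laplacian :: "'v::finite set set \<Rightarrow> ('v \<Rightarrow> 'a::ab_group_add) \<Rightarrow> 'v \<Rightarrow> 'a" where
  "graph_laplacian E x a = (\<Sum>b | {a, b} \<in> E. x a - x b)"

lemma sum_swap_if_sym:
  assumes "sym A"
  shows "(\<Sum>(a, b)\<in>A. f a b) = (\<Sum>(a, b)\<in>A. f b a)"
  by (rule sum.reindex_bij_witness[of _ prod.swap prod.swap]) (use assms in \<open>auto dest: symD\<close>)

lemma sum_graph_laplacian:
  fixes x :: "'v::finite \<Rightarrow> 'a::ab_group_add"
  shows "(\<Sum>a\<in>C. graph_laplacian E x a) = (\<Sum>(a, b)\<in>cut_arcs E C. x a - x b)"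
proof -
  let ?I = "{(a, b). {a, b} \<in> E \<and> a \<in> C \<and> b \<in> C}"
  have "sym ?I" by (auto simp: sym_def insert_commute)
  then have inner_arcs: "(\<Sum>(a, b)\<in>?I. x a) = (\<Sum>(a, b)\<in>?I. x b)"
    by (rule sum_swap_if_sym)
  have "(\<Sum>a\<in>C. graph_laplacian E x a) = (\<Sum>(a, b)\<in>(SIGMA a:C. {b. {a, b} \<in> E}). x a - x b)"
    unfolding graph_laplacian_def by (rule sum.Sigma) simp_all
  also have "(SIGMA a:C. {b. {a, b} \<in> E}) = ?I \<union> cut_arcs E C"
    by (auto simp: cut_arcs_def)
  also have "(\<Sum>(a, b)\<in>?I \<union> cut_arcs E C. x a - x b)
      = (\<Sum>(a, b)\<in>?I. x a - x b) + (\<Sum>(a, b)\<in>cut_arcs E C. x a - x b)"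
    by (rule sum.union_disjoint) (auto simp: cut_arcs_def)
  also have "(\<Sum>(a, b)\<in>?I. x a - x b) = 0"
    using inner_arcs by (simp add: case_prod_unfold sum_subtractf)
  finally show ?thesis by simp
qed

theorem num_spanning_trees_mult_diff:
  fixes x :: "'v::finite \<Rightarrow> 'a::ring_1"
  assumes "simple_graph E"
  shows "of_nat (num_spanning_trees E) * (x s - x r)
    = (\<Sum>F\<in>separating_forests E s r. \<Sum>a\<in>component F s. graph_laplacian E x a)"
proof -
  have "of_nat (num_spanning_trees E) * (x s - x r)
      = (\<Sum>T | spanning_tree E T. \<Sum>(a, b)\<in>path_arcs T s r. x a - x b)"
    using assms by (simp add: num_spanning_trees_def spanning_tree_iff sum_path_arcs
        graph_connected_iff)
  also have "\<dots> = (\<Sum>(T, a, b)\<in>(SIGMA T:{T. spanning_tree E T}. path_arcs T s r). x a - x b)"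
    by (subst sum.Sigma) (simp_all add: case_prod_unfold)
  also have "\<dots> = (\<Sum>(F, a, b)\<in>(SIGMA F:separating_forests E s r. cut_arcs E (component F s)).
      x a - x b)"
    using sum.reindex_bij_betw[OF bij_betw_delete_path_arc[OF assms, of s r],
      of "\<lambda>(F, a, b). x a - x b"] by (simp add: case_prod_unfold)
  also have "\<dots> = (\<Sum>F\<in>separating_forests E s r. \<Sum>(a, b)\<in>cut_arcs E (component F s). x a - x b)"
    by (subst sum.Sigma) (simp_all add: case_prod_unfold)
  also have "\<dots> = (\<Sum>F\<in>separating_forests E s r. \<Sum>a\<in>component F s. graph_laplacian E x a)"
    by (simp add: sum_graph_laplacian)
  finally show ?thesis .
qed

lemma additive_graph_laplacian:
  assumes "Modules.additive \<phi>"
  shows "\<phi> (graph_laplacian E x a) = graph_laplacian E (\<lambda>v. \<phi> (x v)) a"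
  unfolding graph_laplacian_def
  by (simp add: Modules.additive.sum[OF assms] Modules.additive.diff[OF assms])

lemma sum_mult_graph_laplacian:
  fixes x :: "'v::finite \<Rightarrow> 'a::comm_ring_1"
  shows "2 * (\<Sum>a\<in>UNIV. x a * graph_laplacian E x a) = (\<Sum>(a, b) | {a, b} \<in> E. (x a - x b)\<^sup>2)"
proof -
  let ?A = "{(a, b). {a, b} \<in> E}"
  have "(\<Sum>a\<in>UNIV. x a * graph_laplacian E x a)
      = (\<Sum>(a, b)\<in>(SIGMA a:UNIV. {b. {a, b} \<in> E}). x a * (x a - x b))"
    unfolding graph_laplacian_def sum_distrib_left by (rule sum.Sigma) simp_all
  also have "(SIGMA a:UNIV. {b. {a, b} \<in> E}) = ?A" by auto
  finally have sum_over_arcs: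
    "(\<Sum>a\<in>UNIV. x a * graph_laplacian E x a) = (\<Sum>(a, b)\<in>?A. x a * (x a - x b))" .
  have "sym ?A" by (auto simp: sym_def insert_commute)
  then have "(\<Sum>(a, b)\<in>?A. x a * (x a - x b)) = (\<Sum>(a, b)\<in>?A. x b * (x b - x a))"
    by (rule sum_swap_if_sym)
  with sum_over_arcs have "2 * (\<Sum>a\<in>UNIV. x a * graph_laplacian E x a)
      = (\<Sum>(a, b)\<in>?A. x a * (x a - x b)) + (\<Sum>(a, b)\<in>?A. x b * (x b - x a))"
    by simp
  also have "\<dots> = (\<Sum>(a, b)\<in>?A. (x a - x b)\<^sup>2)"
    by (simp add: sum.distrib[symmetric] case_prod_unfold power2_eq_square algebra_simps)
  finally show ?thesis .
qed

lemma vertex_degree_eq_card_neighbours: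
  assumes "simple_graph E"
  shows "vertex_degree E a = card {b. {a, b} \<in> E}"
proof -
  have "bij_betw (\<lambda>b. {a, b}) {b. {a, b} \<in> E} {e \<in> E. a \<in> e}"
  proof (rule bij_betwI')
    fix e assume incident: "e \<in> {e \<in> E. a \<in> e}"
    then have "card e = 2" using assms by (simp add: simple_graph_def)
    then obtain c d where "e = {c, d}" by (meson card_2_iff)
    then have "e = {a, c} \<or> e = {a, d}" using incident by auto
    then show "\<exists>b\<in>{b. {a, b} \<in> E}. e = {a, b}" using incident by blast
  qed (auto simp: doubleton_eq_iff)
  then show ?thesis by (simp add: vertex_degree_def bij_betw_same_card)
qed

lemma laplacian_matrix_mult_nth:
  assumes "simple_graph E"
  shows "(laplacian_matrix E *v x) $ a = graph_laplacian E (($) x) a"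
proof -
  have "(laplacian_matrix E *v x) $ a
      = (\<Sum>b\<in>UNIV. (if a = b then real (vertex_degree E a) * x $ b else 0))
        - (\<Sum>b\<in>UNIV. if {a, b} \<in> E then x $ b else 0)"
    unfolding laplacian_matrix_def degree_matrix_def adjacency_matrix_def matrix_vector_mult_def
    by (simp add: sum_subtractf left_diff_distrib if_distrib[of "\<lambda>c. c * _"] cong: if_cong)
  also have "\<dots> = real (vertex_degree E a) * x $ a - (\<Sum>b | {a, b} \<in> E. x $ b)"
    by (simp add: sum.If_cases)
  also have "\<dots> = graph_laplacian E (($) x) a"
    by (simp add: graph_laplacian_def sum_subtractf vertex_degree_eq_card_neighbours[OF assms])
  finally show ?thesis .
qed

lemma laplacian_eigenspace_iff:
  assumes "simple_graph E"
  shows "x \<in> laplacian_eigenspace E \<theta> \<longleftrightarrow> (\<forall>a. graph_laplacian E (($) x) a = \<theta> * x $ a)"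
  by (simp add: laplacian_eigenspace_def vec_eq_iff laplacian_matrix_mult_nth[OF assms])

lemma laplacian_eigenvalue_iff:
  "laplacian_eigenvalue E \<theta> \<longleftrightarrow> (\<exists>x \<in> laplacian_eigenspace E \<theta>. x \<noteq> 0)"
  unfolding laplacian_eigenvalue_def laplacian_eigenspace_def by blast

lemma laplacian_eigenvalue_nonneg:
  assumes "simple_graph E" "laplacian_eigenvalue E \<theta>"
  shows "0 \<le> \<theta>"
proof -
  obtain x where x: "x \<in> laplacian_eigenspace E \<theta>" "x \<noteq> 0"
    using assms(2) by (auto simp: laplacian_eigenvalue_iff)
  have "\<theta> * (x \<bullet> x) = (\<Sum>a\<in>UNIV. x $ a * graph_laplacian E (($) x) a)"
    using x(1)
    by (simp add: laplacian_eigenspace_iff[OF assms(1)] inner_vec_def sum_distrib_left mult_ac)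
  then have "2 * (\<theta> * (x \<bullet> x)) = (\<Sum>(a, b) | {a, b} \<in> E. (x $ a - x $ b)\<^sup>2)"
    by (simp only: sum_mult_graph_laplacian)
  also have "\<dots> \<ge> 0" by (intro sum_nonneg) auto
  finally have "0 \<le> \<theta> * (x \<bullet> x)" by simp
  moreover have "0 < x \<bullet> x" using x(2) by simp
  ultimately show ?thesis using zero_le_mult_iff[of \<theta> "x \<bullet> x"] by linarith
qed

lemma orthogonal_projection_inner:
  assumes "subspace S" "z \<in> S"
  shows "orthogonal_projection S x \<bullet> z = x \<bullet> z"
proof -
  have "orthogonal (x - orthogonal_projection S x) z"
    using theI'[OF orthogonal_projection_unique[OF assms(1), of x]] assms(2)
    unfolding orthogonal_projection_def by blast
  then show ?thesis by (simp add: orthogonal_def inner_diff_left)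
qed

lemma eigenvector_antisymmetric:
  assumes "\<theta> \<in> eigenvalue_support_minus E u v" "x \<in> laplacian_eigenspace E \<theta>"
  shows "x $ u = - x $ v"
proof -
  have proj_nth: "laplacian_proj E \<theta> (axis w 1) \<bullet> x = x $ w" for w
    using orthogonal_projection_inner[OF subspace_laplacian_eigenspace assms(2)]
    by (simp add: laplacian_proj_def inner_axis')
  have "laplacian_proj E \<theta> (axis u 1) = - laplacian_proj E \<theta> (axis v 1)"
    using assms(1) by (simp add: eigenvalue_support_minus_def)
  then show ?thesis using proj_nth[of u] proj_nth[of v] by simp
qed

section \<open>Integer eigenvalues\<close>

lemma rat_linear_functional_exists:
  fixes c :: "'a::field_char_0"
  assumes "c \<noteq> 0"
  obtains \<phi> :: "'a \<Rightarrow> rat"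
  where "Vector_Spaces.linear (\<lambda>q x. of_rat q * x) (*) \<phi>" "\<phi> c \<noteq> 0"
proof -
  interpret vector_space_pair "\<lambda>q (x::'a). of_rat q * x" "(*) :: rat \<Rightarrow> rat \<Rightarrow> rat"
    by unfold_locales (simp_all add: algebra_simps of_rat_add of_rat_mult)
  show thesis
    using linear_independent_extend[of "{c}" "\<lambda>_. 1"] assms that by auto
qed

lemma common_denominator_exists:
  fixes f :: "'i \<Rightarrow> rat"
  assumes "finite A"
  shows "\<exists>d::int. d \<noteq> 0 \<and> (\<forall>i\<in>A. of_int d * f i \<in> \<int>)"
  using assms
proof (induction A rule: finite_induct)
  case empty
  show ?case by (rule exI[of _ 1]) simp
next
  case (insert j A)
  then obtain d where denom: "d \<noteq> 0" "\<forall>i\<in>A. of_int d * f i \<in> \<int>" by blast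
  obtain n e where quotient: "quotient_of (f j) = (n, e)" by fastforce
  then have "e \<noteq> 0" and clears: "of_int e * f j = of_int n"
    using quotient_of_denom_pos[OF quotient] quotient_of_div[OF quotient] by simp_all
  have "of_int d * (of_int e * f j) \<in> \<int>"
    unfolding clears by (intro Ints_mult Ints_of_int)
  moreover have "of_int e * (of_int d * f i) \<in> \<int>" if "i \<in> A" for i
    by (rule Ints_mult) (use denom(2) that in simp_all)
  ultimately have "\<forall>i\<in>insert j A. of_int (d * e) * f i \<in> \<int>"
    by (simp add: mult_ac)
  then show ?case using denom(1) \<open>e \<noteq> 0\<close> by (intro exI[of _ "d * e"]) simp
qed

lemma additive_int_valued_functional_exists:
  fixes x :: "'i::finite \<Rightarrow> 'a::field_char_0"
  assumes "x j \<noteq> 0"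
  obtains \<phi> :: "'a \<Rightarrow> rat" and z :: "'i \<Rightarrow> int"
  where "Modules.additive \<phi>" "\<And>n t. \<phi> (of_int n * t) = of_int n * \<phi> t"
    "\<And>i. \<phi> (x i) = of_int (z i)" "z j \<noteq> 0"
proof -
  obtain \<psi> :: "'a \<Rightarrow> rat"
    where linear: "Vector_Spaces.linear (\<lambda>q x. of_rat q * x) (*) \<psi>" and nonzero: "\<psi> (x j) \<noteq> 0"
    using rat_linear_functional_exists[OF assms] by blast
  interpret \<psi>: Vector_Spaces.linear "\<lambda>q x. of_rat q * x" "(*)" \<psi>
    by (fact linear)
  obtain d where denom: "d \<noteq> 0" "\<forall>i\<in>UNIV. of_int d * \<psi> (x i) \<in> \<int>"
    using common_denominator_exists[OF finite, of UNIV "\<lambda>i. \<psi> (x i)"] by (elim exE conjE)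
  then have "\<forall>i. \<exists>n. of_int d * \<psi> (x i) = of_int n"
    by (blast elim: Ints_cases)
  then obtain z where z_eq: "\<And>i. of_int d * \<psi> (x i) = of_int (z i)"
    by metis
  show thesis
  proof (rule that[of "\<lambda>t. of_int d * \<psi> t" z])
    show "Modules.additive (\<lambda>t. of_int d * \<psi> t)"
      by (rule Modules.additive.intro) (simp add: \<psi>.add distrib_left)
    show "of_int d * \<psi> (of_int n * t) = of_int n * (of_int d * \<psi> t)" for n t
      using \<psi>.scale[of "of_int n" t] by simp
    show "z j \<noteq> 0" using z_eq[of j] denom(1) nonzero by (metis mult_eq_0_iff of_int_eq_0_iff)
  qed (rule z_eq)
qed

lemma antisymmetric_int_eigenvector_dvd:
  fixes z :: "'v::finite \<Rightarrow> int"
  assumes "simple_graph E" and eigen: "\<And>a. graph_laplacian E z a = m * z a"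
    and "z u = - z v" "z j \<noteq> 0"
  shows "m dvd 2 * int (num_spanning_trees E)"
proof -
  let ?\<tau> = "int (num_spanning_trees E)"
  define g where "g = Gcd (range z)"
  have "g \<noteq> 0" using assms(4) by (auto simp: g_def)
  have g_dvd: "g dvd z a" for a by (simp add: g_def)
  have diff_dvd: "m * g dvd ?\<tau> * (z s - z r)" for s r
    unfolding num_spanning_trees_mult_diff[OF assms(1), of z s r, simplified] eigen
    by (intro dvd_sum mult_dvd_mono g_dvd dvd_refl)
  have "m * g dvd 2 * ?\<tau> * z s" for s
  proof -
    have "m * g dvd ?\<tau> * (z s - z u) + ?\<tau> * (z s - z v)"
      by (intro dvd_add diff_dvd)
    also have "\<dots> = 2 * ?\<tau> * z s" using assms(3) by (simp add: algebra_simps)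
    finally show ?thesis .
  qed
  then have "m * g dvd Gcd ((*) (2 * ?\<tau>) ` range z)"
    by (intro Gcd_greatest) auto
  then have "m * g dvd (2 * ?\<tau>) * g"
    by (simp only: Gcd_mult dvd_normalize_iff g_def)
  then show ?thesis using \<open>g \<noteq> 0\<close> by simp
qed

lemma antisymmetric_eigenvector_dvd:
  fixes x :: "'v::finite \<Rightarrow> 'a::field_char_0"
  assumes "simple_graph E" and eigen: "\<And>a. graph_laplacian E x a = of_int m * x a"
    and "x u = - x v" "x j \<noteq> 0"
  shows "m dvd 2 * int (num_spanning_trees E)"
proof -
  obtain \<phi> :: "'a \<Rightarrow> rat" and z :: "'v \<Rightarrow> int"
    where \<phi>: "Modules.additive \<phi>" "\<And>n t. \<phi> (of_int n * t) = of_int n * \<phi> t"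
      and z_eq: "\<And>a. \<phi> (x a) = of_int (z a)" and nonzero: "z j \<noteq> 0"
    using additive_int_valued_functional_exists[of x j] assms(4) by blast
  have "rat_of_int (graph_laplacian E z a) = of_int (m * z a)" for a
  proof -
    have "rat_of_int (graph_laplacian E z a) = graph_laplacian E (\<lambda>v. \<phi> (x v)) a"
      by (simp add: additive_graph_laplacian[OF Modules.additive.intro[OF of_int_add]] z_eq)
    also have "\<dots> = \<phi> (of_int m * x a)"
      by (simp add: additive_graph_laplacian[OF \<phi>(1), symmetric] eigen)
    finally show ?thesis by (simp add: \<phi>(2) z_eq)
  qed
  then have eigen_z: "graph_laplacian E z a = m * z a" for a by (simp only: of_int_eq_iff)
  have "rat_of_int (z u) = of_int (- z v)"
    using assms(3) z_eq[of u] z_eq[of v] by (simp add: Modules.additive.minus[OF \<phi>(1)])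
  then have "z u = - z v" by (simp only: of_int_eq_iff)
  with eigen_z nonzero show ?thesis
    by (intro antisymmetric_int_eigenvector_dvd[OF assms(1)])
qed

theorem eigenvalue_support_minus_dvd_twice_num_spanning_trees:
  assumes "simple_graph E" "of_int m \<in> eigenvalue_support_minus E u v"
  shows "m dvd 2 * int (num_spanning_trees E)"
proof -
  have "laplacian_eigenvalue E (of_int m)"
    using assms(2) by (simp add: eigenvalue_support_minus_def eigenvalue_support_def)
  then obtain x j where x: "x \<in> laplacian_eigenspace E (of_int m)" and "x $ j \<noteq> 0"
    by (auto simp: laplacian_eigenvalue_iff vec_eq_iff)
  moreover have "graph_laplacian E (($) x) a = of_int m * x $ a" for a
    using x by (simp add: laplacian_eigenspace_iff[OF assms(1)])
  moreover have "x $ u = - x $ v"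
    using assms(2) x by (rule eigenvector_antisymmetric)
  ultimately show ?thesis
    by (intro antisymmetric_eigenvector_dvd[OF assms(1), of "($) x"])
qed

theorem theorem7:
  fixes E :: "'v::finite set set" and u v :: 'v and \<theta> :: real
  assumes "simple_graph E"
    and "\<exists>k::nat. num_spanning_trees E = 2 ^ k"
    and "laplacian_eigenvalue E \<theta>" and "\<theta> \<in> \<int>" and "\<theta> \<noteq> 0"
    and "\<theta> \<in> eigenvalue_support_minus E u v"
  shows "\<exists>k::nat. \<theta> = 2 ^ k"
proof -
  obtain k where trees_eq: "num_spanning_trees E = 2 ^ k" using assms(2) by blast
  have "\<theta> \<in> \<nat>"
    using assms(4) laplacian_eigenvalue_nonneg[OF assms(1,3)] by (simp add: Nats_altdef2)
  then obtain n where \<theta>_eq: "\<theta> = real n" by (rule Nats_cases)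
  then have "int n dvd 2 * int (num_spanning_trees E)"
    using eigenvalue_support_minus_dvd_twice_num_spanning_trees[OF assms(1)] assms(6)
    by (metis of_int_of_nat_eq)
  also have "2 * int (num_spanning_trees E) = int (2 ^ Suc k)" by (simp add: trees_eq)
  finally have "n dvd 2 ^ Suc k" by (simp only: int_dvd_int_iff)
  then obtain i where "n = 2 ^ i" using divides_primepow_nat[OF two_is_prime_nat] by blast
  then show ?thesis using \<theta>_eq by auto
qed

end
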